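(* Let $p,q\in\mathbb{R}$ with $p>0$. The equation $x^3+px+q=0$ has a unique real solution, namely $$\overline r=\left(-\frac q2+\sqrt{\frac{q^2}{4}+\frac{p^3}{27}}\right)^{1/3}+\left(-\frac q2-\sqrt{\frac{q^2}{4}+\frac{p^3}{27}}\right)^{1/3}.$$
   Context: For a real number $t$, $t^{1/3}$ denotes its real cube root (negative if $t<0$). *)

theory Defs
  imports Complex_Main
begin

end

theory Submission
  imports Defs
begin

(* Substituting x = u + v turns x^3 + p x + q into u^3 + v^3 + q + (3 u v + p) (u + v), which
   vanishes as soon as u^3 + v^3 = -q and u v = -p/3. Thus u^3 and v^3 may be taken to be the
   two roots of the resolvent t^2 + q t - p^3/27, which are real when p > 0. Uniqueness holds
   because the cubic is then strictly increasing. *)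

lemma power_strict_mono_odd:
  fixes a b :: "'a::linordered_idom"
  assumes "odd n" and "a < b"
  shows "a ^ n < b ^ n"
proof -
  have "n > 0"
    using \<open>odd n\<close> by (rule odd_pos)
  consider "0 \<le> a" | "b \<le> 0" | "a < 0" "0 < b"
    by linarith
  then show ?thesis
  proof cases
    assume "0 \<le> a"
    with \<open>a < b\<close> \<open>n > 0\<close> show ?thesis
      by (simp add: power_strict_mono)
  next
    assume "b \<le> 0"
    with \<open>a < b\<close> \<open>n > 0\<close> have "(- b) ^ n < (- a) ^ n"
      by (intro power_strict_mono) simp_all
    with \<open>odd n\<close> show ?thesis
      by simp
  next
    assume "a < 0" and "0 < b"
    with \<open>odd n\<close> have "a ^ n < 0" and "0 < b ^ n"
      by simp_all
    then show ?thesis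
      by (rule less_trans)
  qed
qed

lemma strict_mono_depressed_cubic:
  fixes p q :: "'a::linordered_idom"
  assumes "p \<ge> 0"
  shows "strict_mono (\<lambda>x. x ^ 3 + p * x + q)"
proof (rule strict_monoI)
  fix x y :: 'a
  assume "x < y"
  then have "x ^ 3 < y ^ 3"
    by (simp add: power_strict_mono_odd)
  moreover have "p * x \<le> p * y"
    using \<open>x < y\<close> assms by (simp add: mult_left_mono)
  ultimately show "x ^ 3 + p * x + q < y ^ 3 + p * y + q"
    by (simp add: add_less_le_mono)
qed

lemma depressed_cubic_add_eq_0:
  fixes u v p q :: "'a::comm_ring_1"
  assumes cubes: "u ^ 3 + v ^ 3 = - q" and product: "3 * (u * v) = - p"
  shows "(u + v) ^ 3 + p * (u + v) + q = 0"
proof -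
  have "(u + v) ^ 3 = (u ^ 3 + v ^ 3) + 3 * (u * v) * (u + v)"
    by (simp add: power3_eq_cube algebra_simps)
  also have "\<dots> = - q - p * (u + v)"
    unfolding cubes product by simp
  finally show ?thesis
    by simp
qed

lemma depressed_cubic_add_root_eq_0:
  fixes a b p q :: real
  assumes "a + b = - q" and product: "a * b = (- (p / 3)) ^ 3"
  shows "(root 3 a + root 3 b) ^ 3 + p * (root 3 a + root 3 b) + q = 0"
proof (rule depressed_cubic_add_eq_0)
  show "root 3 a ^ 3 + root 3 b ^ 3 = - q"
    using \<open>a + b = - q\<close> by (simp add: odd_real_root_pow)
  have "root 3 a * root 3 b = root 3 ((- (p / 3)) ^ 3)"
    by (simp only: product flip: real_root_mult)
  also have "\<dots> = - (p / 3)"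
    by (rule odd_real_root_power_cancel) simp
  finally show "3 * (root 3 a * root 3 b) = - p"
    by simp
qed

definition cardano_root :: "real \<Rightarrow> real \<Rightarrow> real" where
  "cardano_root p q =
    root 3 (- (q / 2) + sqrt (q ^ 2 / 4 + p ^ 3 / 27))
      + root 3 (- (q / 2) - sqrt (q ^ 2 / 4 + p ^ 3 / 27))"

lemma depressed_cubic_cardano_root_eq_0:
  fixes p q :: real
  assumes "q ^ 2 / 4 + p ^ 3 / 27 \<ge> 0"
  shows "cardano_root p q ^ 3 + p * cardano_root p q + q = 0"
  unfolding cardano_root_def
proof (rule depressed_cubic_add_root_eq_0)
  let ?s = "sqrt (q ^ 2 / 4 + p ^ 3 / 27)"
  show "(- (q / 2) + ?s) + (- (q / 2) - ?s) = - q"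
    by simp
  have "(- (q / 2) + ?s) * (- (q / 2) - ?s) = q ^ 2 / 4 - ?s ^ 2"
    by (simp add: power2_eq_square algebra_simps)
  also have "\<dots> = (- (p / 3)) ^ 3"
    using assms by (simp add: power_divide)
  finally show "(- (q / 2) + ?s) * (- (q / 2) - ?s) = (- (p / 3)) ^ 3" .
qed

lemma depressed_cubic_eq_0_iff_cardano_root:
  fixes p q x :: real
  assumes "p \<ge> 0"
  shows "x ^ 3 + p * x + q = 0 \<longleftrightarrow> x = cardano_root p q"
proof -
  have "cardano_root p q ^ 3 + p * cardano_root p q + q = 0"
    using assms by (simp add: depressed_cubic_cardano_root_eq_0)
  then show ?thesis
    using strict_mono_eq [OF strict_mono_depressed_cubic [OF assms, of q], of x "cardano_root p q"]
    by simp
qed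

theorem corollary2:
  fixes p q :: real
  assumes "p > 0"
  shows "(\<exists>!x::real. x ^ 3 + p * x + q = 0) \<and>
    (\<forall>x::real. x ^ 3 + p * x + q = 0 \<longleftrightarrow>
      x = root 3 (- (q / 2) + sqrt (q ^ 2 / 4 + p ^ 3 / 27))
        + root 3 (- (q / 2) - sqrt (q ^ 2 / 4 + p ^ 3 / 27)))"
proof -
  have "x ^ 3 + p * x + q = 0 \<longleftrightarrow> x = cardano_root p q" for x
    using assms by (simp add: depressed_cubic_eq_0_iff_cardano_root)
  then show ?thesis
    by (simp add: cardano_root_def)
qed

end
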